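(* Let $r_1,\dots,r_n>0$ and for $\mathbf{t}=(t_1,\dots,t_{2n})$ let \[T(\mathbf{t},t)=\Big|\sin\tfrac{t-t_1}{2}\Big|^{r_n}\cdots\Big|\sin\tfrac{t-t_n}{2}\Big|^{r_1}\Big|\sin\tfrac{t-t_{n+1}}{2}\Big|^{r_1}\cdots\Big|\sin\tfrac{t-t_{2n}}{2}\Big|^{r_n}.\] Consider the problem of minimizing $\sup_{t\in[0,2\pi]}T(\mathbf{t},t)$ over all $\mathbf{t}$ with $0\le t_1\le\dots\le t_n\le t_{n+1}\le\dots\le t_{2n}\le2\pi$ and $t_1+t_{2n}=2\pi$. Then the infimum is attained at a unique point $\mathbf{w}^*=(w_1,\dots,w_{2n})$, which satisfies $w_1+(w_{2n}-2\pi)=0$ and $0<w_1<\dots<w_{2n}<2\pi$. Furthermore $\mathbf{w}^*$ is symmetric: $w_k=2\pi-w_{2n+1-k}$ for $k=1,\dots,n$. *)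

theory Defs
  imports Complex_Main
begin

definition node_exp :: "nat \<Rightarrow> (nat \<Rightarrow> real) \<Rightarrow> nat \<Rightarrow> real" where
  "node_exp n r k = (if k \<le> n then r (n + 1 - k) else r (k - n))"

definition Tfun :: "nat \<Rightarrow> (nat \<Rightarrow> real) \<Rightarrow> (nat \<Rightarrow> real) \<Rightarrow> real \<Rightarrow> real" where
  "Tfun n r tt x = (\<Prod>k = 1..2*n. \<bar>sin ((x - tt k) / 2)\<bar> powr node_exp n r k)"

definition supT :: "nat \<Rightarrow> (nat \<Rightarrow> real) \<Rightarrow> (nat \<Rightarrow> real) \<Rightarrow> real" where
  "supT n r tt = (SUP x\<in>{0..2*pi}. Tfun n r tt x)"

definition admissible :: "nat \<Rightarrow> (nat \<Rightarrow> real) \<Rightarrow> bool" where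
  "admissible n tt \<longleftrightarrow> 0 \<le> tt 1 \<and> (\<forall>k\<in>{1..<2*n}. tt k \<le> tt (Suc k)) \<and>
     tt (2*n) \<le> 2*pi \<and> tt 1 + tt (2*n) = 2*pi"

end

theory Submission
  imports Defs "HOL-Library.Real_Mod" "HOL-Analysis.Function_Topology"
    "Jordan_Normal_Form.Determinant"
begin

text \<open>
  Up to a rotation the admissible points are the cyclically ordered \<open>2 n\<close>-tuples of points on the
  circle. Instead of the minimum of the largest of the \<open>2 n\<close> arc maxima one looks at the maximum of
  the smallest one. Let \<open>w\<close> attain it, with value \<open>M\<close>. Then \<open>M > 0\<close>, so no arc of \<open>w\<close> is degenerate,
  and all arc maxima equal \<open>M\<close>: otherwise one could shrink an arc with a larger maximum, which raises
  the product on all other arcs.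

  For any other \<open>v\<close>, let \<open>z j\<close> be a critical point in the \<open>j\<close>-th nondegenerate arc of \<open>v\<close>, and \<open>y j\<close>
  a maximum point in the corresponding arc of \<open>w\<close>. The function \<open>ln \<bar>sin (x / 2)\<bar>\<close> is strictly
  concave, so the difference of \<open>ln T(w, y j)\<close> and \<open>ln T(v, z j)\<close> is less than a linear form in
  \<open>w - v\<close>. There are positive weights \<open>c j\<close> for which the weighted sum of these forms vanishes.
  Hence \<open>T(v, z j) > M\<close> for some \<open>j\<close>, so \<open>w\<close> is the only minimizer, and it is symmetric since its
  reflection is a minimizer too.
\<close>

section \<open>Orthogonality of rows and columns\<close>

lemma sum_right_inverse_imp_left_inverse:
  fixes A B :: "'a \<Rightarrow> 'a \<Rightarrow> 'b::field"
  assumes "finite J"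
    and right_inverse: "\<And>i k. i \<in> J \<Longrightarrow> k \<in> J \<Longrightarrow> (\<Sum>j\<in>J. A i j * B j k) = (if i = k then 1 else 0)"
    and ik: "i \<in> J" "k \<in> J"
  shows "(\<Sum>j\<in>J. B i j * A j k) = (if i = k then 1 else 0)"
proof -
  define p where "p = card J"
  obtain e where e: "bij_betw e {0..<p} J"
    using ex_bij_betw_nat_finite[OF \<open>finite J\<close>] unfolding p_def by blast
  define mat_of where "mat_of C = mat p p (\<lambda>(a, b). C (e a) (e b))" for C :: "'a \<Rightarrow> 'a \<Rightarrow> 'b"
  have carrier: "mat_of C \<in> carrier_mat p p" for C
    by (simp add: mat_of_def)
  have e_mem: "e a \<in> J" if "a < p" for a
    using e that by (auto simp: bij_betw_def)
  have e_eq_iff: "e a = e b \<longleftrightarrow> a = b" if "a < p" "b < p" for a b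
    using e that by (auto simp: bij_betw_def inj_on_def)
  have mult_entry: "(mat_of C * mat_of D) $$ (a, b) = (\<Sum>j\<in>J. C (e a) j * D j (e b))"
    if "a < p" "b < p" for C D a b
    using that sum.reindex_bij_betw[OF e, of "\<lambda>j. C (e a) j * D j (e b)"]
    by (simp add: mat_of_def scalar_prod_def)
  have "mat_of A * mat_of B = 1\<^sub>m p"
    using carrier by (intro eq_matI) (auto simp: mult_entry right_inverse e_mem e_eq_iff)
  then have left_inverse: "mat_of B * mat_of A = 1\<^sub>m p"
    by (rule mat_mult_left_right_inverse[OF carrier carrier])
  obtain a b where ab: "a < p" "b < p" "i = e a" "k = e b"
    using ik e by (auto simp: bij_betw_def)
  have "(\<Sum>j\<in>J. B i j * A j k) = (mat_of B * mat_of A) $$ (a, b)"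
    using ab by (simp add: mult_entry)
  also have "\<dots> = (if i = k then 1 else 0)"
    using ab by (simp add: left_inverse e_eq_iff)
  finally show ?thesis .
qed

lemma orthogonal_rows_imp_orthogonal_columns:
  fixes a :: "'a \<Rightarrow> 'a \<Rightarrow> 'b::field" and \<rho> norm2 :: "'a \<Rightarrow> 'b" and J :: "'a set"
  defines "norm2 \<equiv> \<lambda>i. \<Sum>k\<in>J. \<rho> k * (a i k)\<^sup>2"
  assumes "finite J"
    and rows: "\<And>i j. i \<in> J \<Longrightarrow> j \<in> J \<Longrightarrow> i \<noteq> j \<Longrightarrow> (\<Sum>k\<in>J. \<rho> k * (a i k * a j k)) = 0"
    and norm2_nonzero: "\<And>i. i \<in> J \<Longrightarrow> norm2 i \<noteq> 0"
    and kl: "k \<in> J" "l \<in> J" "k \<noteq> l" and "\<rho> l \<noteq> 0"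
  shows "(\<Sum>i\<in>J. a i k * a i l / norm2 i) = 0"
proof -
  have right_inverse: "(\<Sum>k\<in>J. \<rho> k * a i k * (a j k / norm2 j)) = (if i = j then 1 else 0)"
    if "i \<in> J" "j \<in> J" for i j
  proof -
    have "(\<Sum>k\<in>J. \<rho> k * a i k * (a j k / norm2 j)) = (\<Sum>k\<in>J. \<rho> k * (a i k * a j k)) / norm2 j"
      by (simp add: sum_divide_distrib mult_ac)
    also have "\<dots> = (if i = j then 1 else 0)"
      using rows[OF that] norm2_nonzero[OF that(2)] by (auto simp: norm2_def power2_eq_square)
    finally show ?thesis .
  qed
  have "(\<Sum>i\<in>J. a i k / norm2 i * (\<rho> l * a i l)) = 0"
    using sum_right_inverse_imp_left_inverse[OF \<open>finite J\<close>,
        of "\<lambda>i k. \<rho> k * a i k" "\<lambda>k j. a j k / norm2 j", OF right_inverse kl(1,2)] kl(3) by simp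
  also have "(\<Sum>i\<in>J. a i k / norm2 i * (\<rho> l * a i l)) = \<rho> l * (\<Sum>i\<in>J. a i k * a i l / norm2 i)"
    by (simp add: sum_distrib_left mult_ac)
  finally show ?thesis using \<open>\<rho> l \<noteq> 0\<close> by simp
qed

lemma cot_diff:
  fixes x y :: real
  assumes "sin x \<noteq> 0" "sin y \<noteq> 0"
  shows "cot x - cot y = sin (y - x) / (sin x * sin y)"
  using assms by (simp add: cot_def sin_diff field_simps)

lemma sum_cot_diff:
  fixes c \<alpha> \<beta> :: "'a \<Rightarrow> real"
  assumes "\<And>k. k \<in> K \<Longrightarrow> sin (\<alpha> k) \<noteq> 0" "\<And>k. k \<in> K \<Longrightarrow> sin (\<beta> k) \<noteq> 0"
    and "\<And>k. k \<in> K \<Longrightarrow> \<beta> k - \<alpha> k = \<delta>"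
  shows "(\<Sum>k\<in>K. c k * (cot (\<alpha> k) - cot (\<beta> k))) = sin \<delta> * (\<Sum>k\<in>K. c k / (sin (\<alpha> k) * sin (\<beta> k)))"
  unfolding sum_distrib_left using assms by (intro sum.cong refl) (simp add: cot_diff)

lemma cot_critical_points_orthogonal:
  fixes s \<rho> :: "'a \<Rightarrow> real"
  assumes "\<And>k. k \<in> K \<Longrightarrow> sin ((x - s k) / 2) \<noteq> 0" "\<And>k. k \<in> K \<Longrightarrow> sin ((y - s k) / 2) \<noteq> 0"
    and "(\<Sum>k\<in>K. \<rho> k * cot ((x - s k) / 2)) = 0" "(\<Sum>k\<in>K. \<rho> k * cot ((y - s k) / 2)) = 0"
    and "sin ((y - x) / 2) \<noteq> 0"
  shows "(\<Sum>k\<in>K. \<rho> k / (sin ((x - s k) / 2) * sin ((y - s k) / 2))) = 0"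
proof -
  have "0 = (\<Sum>k\<in>K. \<rho> k * (cot ((x - s k) / 2) - cot ((y - s k) / 2)))"
    using assms(3,4) by (simp add: right_diff_distrib sum_subtractf)
  also have "\<dots> = sin ((y - x) / 2) * (\<Sum>k\<in>K. \<rho> k / (sin ((x - s k) / 2) * sin ((y - s k) / 2)))"
    using assms(1,2) by (intro sum_cot_diff) (auto simp: field_simps)
  finally show ?thesis using assms(5) by simp
qed

lemma constant_column_sum_eq_0:
  fixes a :: "'a \<Rightarrow> 'b \<Rightarrow> 'c::field"
  assumes rows: "\<And>j. j \<in> J \<Longrightarrow> (\<Sum>k\<in>K. \<rho> k * a j k) = 0"
    and columns: "\<And>k. k \<in> K \<Longrightarrow> (\<Sum>j\<in>J. c j * a j k) = C" and "(\<Sum>k\<in>K. \<rho> k) \<noteq> 0"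
  shows "C = 0"
proof -
  have "(\<Sum>k\<in>K. \<rho> k) * C = (\<Sum>k\<in>K. \<rho> k * (\<Sum>j\<in>J. c j * a j k))"
    by (simp add: sum_distrib_right columns cong: sum.cong)
  also have "\<dots> = (\<Sum>j\<in>J. c j * (\<Sum>k\<in>K. \<rho> k * a j k))"
    unfolding sum_distrib_left by (subst sum.swap) (simp add: mult_ac)
  also have "\<dots> = 0" by (simp add: rows)
  finally show ?thesis using \<open>(\<Sum>k\<in>K. \<rho> k) \<noteq> 0\<close> by simp
qed

text \<open>By the critical point equations the rows \<open>1 / sin ((z j - s k) / 2)\<close> are orthogonal for the
  weights \<open>\<rho>\<close>. The matrix is square, so its columns are orthogonal for the inverse squared norms of
  the rows. Read backwards, this says that the sum in the conclusion does not depend on \<open>k\<close>;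
  averaging it with the weights \<open>\<rho>\<close> shows that it vanishes.\<close>

lemma cot_critical_points_dual_weights:
  fixes z s \<rho> :: "'a \<Rightarrow> real"
  assumes "finite J"
    and \<rho>_pos: "\<And>k. k \<in> J \<Longrightarrow> \<rho> k > 0"
    and off: "\<And>j k. j \<in> J \<Longrightarrow> k \<in> J \<Longrightarrow> sin ((z j - s k) / 2) \<noteq> 0"
    and distinct: "\<And>i j. i \<in> J \<Longrightarrow> j \<in> J \<Longrightarrow> i \<noteq> j \<Longrightarrow> sin ((z j - z i) / 2) \<noteq> 0"
    and critical: "\<And>j. j \<in> J \<Longrightarrow> (\<Sum>k\<in>J. \<rho> k * cot ((z j - s k) / 2)) = 0"
  obtains c where "\<And>j. j \<in> J \<Longrightarrow> c j > 0"
    and "\<And>k. k \<in> J \<Longrightarrow> (\<Sum>j\<in>J. c j * cot ((z j - s k) / 2)) = 0"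
proof
  define a where "a j k = 1 / sin ((z j - s k) / 2)" for j k
  define norm2 where "norm2 j = (\<Sum>k\<in>J. \<rho> k * (a j k)\<^sup>2)" for j
  define c where "c j = 1 / norm2 j" for j
  define C where "C k = (\<Sum>j\<in>J. c j * cot ((z j - s k) / 2))" for k
  have norm2_pos: "norm2 j > 0" if "j \<in> J" for j
    unfolding norm2_def using \<open>finite J\<close> that \<rho>_pos off by (intro sum_pos) (auto simp: a_def)
  then show "c j > 0" if "j \<in> J" for j
    using that by (simp add: c_def)
  have rows: "(\<Sum>k\<in>J. \<rho> k * (a i k * a j k)) = 0" if "i \<in> J" "j \<in> J" "i \<noteq> j" for i j
    using cot_critical_points_orthogonal[of J "z i" s "z j" \<rho>] off critical distinct that
    by (simp add: a_def)
  have C_const: "C k = C l" if "k \<in> J" "l \<in> J" for k l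
  proof (cases "k = l")
    case False
    have columns: "(\<Sum>j\<in>J. a j k * a j l / norm2 j) = 0"
      unfolding norm2_def using norm2_pos \<rho>_pos[OF that(2)] that False
      by (intro orthogonal_rows_imp_orthogonal_columns \<open>finite J\<close> rows) (auto simp: norm2_def less_le)
    have "C k - C l = (\<Sum>j\<in>J. c j * (cot ((z j - s k) / 2) - cot ((z j - s l) / 2)))"
      by (simp add: C_def right_diff_distrib sum_subtractf)
    also have "\<dots> = sin ((s k - s l) / 2) * (\<Sum>j\<in>J. a j k * a j l / norm2 j)"
      using off that by (subst sum_cot_diff[where \<delta> = "(s k - s l) / 2"])
        (simp_all add: a_def c_def diff_divide_distrib mult_ac)
    finally show ?thesis using columns by simp
  qed simp
  show "C k = 0" if k: "k \<in> J" for k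
  proof (rule constant_column_sum_eq_0[OF critical])
    show "(\<Sum>j\<in>J. c j * cot ((z j - s l) / 2)) = C k" if "l \<in> J" for l
      using C_const[OF that k] by (simp add: C_def)
    have "(\<Sum>l\<in>J. \<rho> l) > 0"
      using \<open>finite J\<close> k \<rho>_pos by (intro sum_pos) auto
    then show "(\<Sum>l\<in>J. \<rho> l) \<noteq> 0" by simp
  qed
qed

section \<open>The logarithm of the half-angle sine\<close>

lemma abs_sin_half_rcong:
  assumes "[x = y] (rmod (2 * pi))"
  shows "\<bar>sin (x / 2)\<bar> = \<bar>sin (y / 2)\<bar>"
proof -
  obtain n where "y = x + of_int n * (2 * pi)"
    using assms by (auto simp: rcong_altdef)
  then have half_angle: "y / 2 = x / 2 + pi * of_int n" by (simp add: field_simps)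
  show ?thesis unfolding half_angle by (simp add: sin_add abs_mult)
qed

lemma cot_half_rcong:
  assumes "[x = y] (rmod (2 * pi))"
  shows "cot (x / 2) = cot (y / 2)"
proof -
  obtain n where "y = x + of_int n * (2 * pi)"
    using assms by (auto simp: rcong_altdef)
  then have half_angle: "y / 2 = x / 2 + pi * of_int n" by (simp add: field_simps)
  show ?thesis unfolding half_angle by (simp add: cot_def sin_add cos_add)
qed

lemma sin_half_nonzero:
  assumes "x \<noteq> 0" "\<bar>x\<bar> < 2 * pi"
  shows "sin (x / 2) \<noteq> 0"
  using assms sin_gt_zero[of "\<bar>x\<bar> / 2"] by (auto simp: abs_if split: if_splits)

definition same_branch :: "real \<Rightarrow> real \<Rightarrow> bool" where
  "same_branch u v \<longleftrightarrow> u \<in> {0<..<2*pi} \<and> v \<in> {0<..<2*pi} \<or> u \<in> {-2*pi<..<0} \<and> v \<in> {-2*pi<..<0}"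

lemma same_branch_sin_half_nonzero:
  assumes "same_branch u v"
  shows "sin (u / 2) \<noteq> 0" "sin (v / 2) \<noteq> 0"
  using assms by (intro sin_half_nonzero; auto simp: same_branch_def)+

lemma cot_half_strict_antimono:
  assumes "same_branch u v" "u < v"
  shows "cot (v / 2) < cot (u / 2)"
proof -
  have "sin (u / 2) * sin (v / 2) > 0"
    using assms(1) sin_gt_zero[of "u / 2"] sin_gt_zero[of "v / 2"]
      sin_gt_zero[of "- u / 2"] sin_gt_zero[of "- v / 2"]
    by (auto simp: same_branch_def mult_neg_neg)
  moreover have "sin (v / 2 - u / 2) > 0"
    using assms by (intro sin_gt_zero) (auto simp: same_branch_def)
  ultimately have "cot (u / 2) - cot (v / 2) > 0"
    using same_branch_sin_half_nonzero[OF assms(1)] by (simp add: cot_diff)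
  then show ?thesis by simp
qed

lemma strict_antimono_deriv_imp_below_tangent:
  fixes f f' :: "real \<Rightarrow> real"
  assumes "connected A" and deriv: "\<And>x. x \<in> A \<Longrightarrow> (f has_real_derivative f' x) (at x)"
    and anti: "strict_antimono_on A f'" and uv: "u \<in> A" "v \<in> A" "u \<noteq> v"
  shows "f v < f u + f' u * (v - u)"
proof -
  have mvt: "\<exists>y\<in>A. a < y \<and> y < b \<and> f b - f a = (b - a) * f' y" if "a \<in> A" "b \<in> A" "a < b" for a b
  proof -
    have "x \<in> A" if "a \<le> x" "x \<le> b" for x
      using connectedD_interval[OF \<open>connected A\<close> \<open>a \<in> A\<close> \<open>b \<in> A\<close> that] .
    then show ?thesis using MVT2[OF \<open>a < b\<close>, of f f'] deriv by (metis less_imp_le)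
  qed
  consider "u < v" | "v < u" using uv(3) by linarith
  then show ?thesis
  proof cases
    case 1
    then obtain y where y: "y \<in> A" "u < y" "f v - f u = (v - u) * f' y"
      using mvt[of u v] uv by blast
    have "(v - u) * f' y < (v - u) * f' u"
      using 1 monotone_onD[OF anti uv(1) y(1,2)] by (intro mult_strict_left_mono) auto
    with y(3) show ?thesis by (simp add: mult.commute)
  next
    case 2
    then obtain y where y: "y \<in> A" "y < u" "f u - f v = (u - v) * f' y"
      using mvt[of v u] uv by blast
    have "(u - v) * f' u < (u - v) * f' y"
      using 2 monotone_onD[OF anti y(1) uv(1) y(2)] by (intro mult_strict_left_mono) auto
    with y(3) show ?thesis by (simp add: algebra_simps)
  qed
qed

lemma ln_power2_abs: "ln (x\<^sup>2) = 2 * ln \<bar>x\<bar>" for x :: real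
  using ln_realpow[of "\<bar>x\<bar>" 2] by (cases "x = 0") auto

definition log_sin_half :: "real \<Rightarrow> real" where
  "log_sin_half x = ln \<bar>sin (x / 2)\<bar>"

lemma log_sin_half_has_derivative:
  assumes "sin (x / 2) \<noteq> 0"
  shows "(log_sin_half has_real_derivative cot (x / 2) / 2) (at x)"
proof -
  have log_sin_half_eq: "log_sin_half = (\<lambda>x. ln ((sin (x / 2))\<^sup>2) / 2)"
    by (simp add: log_sin_half_def ln_power2_abs fun_eq_iff)
  show ?thesis
    unfolding log_sin_half_eq using assms
    by (auto intro!: derivative_eq_intros simp: cot_def power2_eq_square field_simps
        simp flip: not_real_square_gt_zero)
qed

lemma log_sin_half_below_tangent:
  assumes "same_branch u v" "u \<noteq> v"
  shows "log_sin_half v < log_sin_half u + cot (u / 2) / 2 * (v - u)"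
proof -
  obtain A where A: "A = {0<..<2*pi} \<or> A = {-2*pi<..<0}" and uv: "u \<in> A" "v \<in> A"
    using assms(1) unfolding same_branch_def by blast
  have branch: "same_branch x y" if "x \<in> A" "y \<in> A" for x y
    using that A by (auto simp: same_branch_def)
  show ?thesis
  proof (rule strict_antimono_deriv_imp_below_tangent[OF _ _ _ uv assms(2)])
    show "connected A" using A by auto
    show "(log_sin_half has_real_derivative cot (x / 2) / 2) (at x)" if "x \<in> A" for x
      using same_branch_sin_half_nonzero(1)[OF branch[OF that that]]
      by (rule log_sin_half_has_derivative)
    show "strict_antimono_on A (\<lambda>x. cot (x / 2) / 2)"
      using branch cot_half_strict_antimono by (intro monotone_onI) auto
  qed
qed

section \<open>Products of powers of sines\<close>

definition sin_prod :: "nat \<Rightarrow> (nat \<Rightarrow> real) \<Rightarrow> (nat \<Rightarrow> real) \<Rightarrow> real \<Rightarrow> real" where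
  "sin_prod N q t x = (\<Prod>k = 1..N. \<bar>sin ((x - t k) / 2)\<bar> powr q k)"

definition cot_sum :: "nat \<Rightarrow> (nat \<Rightarrow> real) \<Rightarrow> (nat \<Rightarrow> real) \<Rightarrow> real \<Rightarrow> real" where
  "cot_sum N q t x = (\<Sum>k = 1..N. q k * cot ((x - t k) / 2))"

definition off_nodes :: "nat \<Rightarrow> (nat \<Rightarrow> real) \<Rightarrow> real \<Rightarrow> bool" where
  "off_nodes N t x \<longleftrightarrow> (\<forall>k\<in>{1..N}. sin ((x - t k) / 2) \<noteq> 0)"

lemma sin_prod_nonneg: "sin_prod N q t x \<ge> 0"
  by (auto simp: sin_prod_def intro!: prod_nonneg)

lemma sin_prod_pos_iff: "sin_prod N q t x > 0 \<longleftrightarrow> off_nodes N t x"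
  using sin_prod_nonneg[of N q t x] by (auto simp: less_le sin_prod_def off_nodes_def)

lemma sin_prod_cong:
  assumes "\<And>k. k \<in> {1..N} \<Longrightarrow> s k = t k"
  shows "sin_prod N q s = sin_prod N q t"
  unfolding sin_prod_def using assms by (intro ext prod.cong) auto

lemma sin_prod_shift: "sin_prod N q (\<lambda>k. t k + c) (x + c) = sin_prod N q t x"
  by (simp add: sin_prod_def)

lemma sin_prod_rcong:
  assumes "[x = y] (rmod (2 * pi))"
  shows "sin_prod N q t x = sin_prod N q t y"
  unfolding sin_prod_def
  by (intro prod.cong refl arg_cong2[of _ _ _ _ "(powr)"] abs_sin_half_rcong) (simp add: assms)

lemma ln_sin_prod:
  assumes "off_nodes N t x"
  shows "ln (sin_prod N q t x) = (\<Sum>k = 1..N. q k * log_sin_half (x - t k))"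
  unfolding sin_prod_def using assms
  by (subst ln_prod) (auto simp: off_nodes_def log_sin_half_def ln_powr)

lemma sin_prod_has_derivative:
  assumes "off_nodes N t x"
  shows "(sin_prod N q t has_real_derivative sin_prod N q t x * (cot_sum N q t x / 2)) (at x)"
proof -
  let ?s = "\<lambda>k x. sin ((x - t k) / 2)"
  have factor_deriv: "((\<lambda>x. \<bar>?s k x\<bar> powr q k) has_real_derivative
      \<bar>?s k x\<bar> powr q k * (q k * cot ((x - t k) / 2) / 2)) (at x)"
    if "k \<in> {1..N}" for k
  proof -
    have nonzero: "?s k x \<noteq> 0" using assms that by (simp add: off_nodes_def)
    then have pos: "(?s k x)\<^sup>2 > 0" by simp
    have "((\<lambda>x. (?s k x)\<^sup>2) has_real_derivative ?s k x * cos ((x - t k) / 2)) (at x)"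
      by (auto intro!: derivative_eq_intros)
    from DERIV_powr[OF this pos DERIV_const, of "q k / 2"]
    have "((\<lambda>x. (?s k x)\<^sup>2 powr (q k / 2)) has_real_derivative
        (?s k x)\<^sup>2 powr (q k / 2) * (q k * cot ((x - t k) / 2) / 2)) (at x)"
      by (rule DERIV_cong) (use nonzero in \<open>simp add: cot_def power2_eq_square field_simps\<close>)
    moreover have "(?s k y)\<^sup>2 powr (q k / 2) = \<bar>?s k y\<bar> powr q k" for y
      by (simp add: powr_def ln_power2_abs)
    ultimately show ?thesis by simp
  qed
  have "(sin_prod N q t has_real_derivative sin_prod N q t x *
      (\<Sum>k = 1..N. \<bar>?s k x\<bar> powr q k * (q k * cot ((x - t k) / 2) / 2) / (\<bar>?s k x\<bar> powr q k))) (at x)"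
    unfolding sin_prod_def using assms
    by (intro has_field_derivative_prod' factor_deriv) (auto simp: off_nodes_def)
  also have "(\<Sum>k = 1..N. \<bar>?s k x\<bar> powr q k * (q k * cot ((x - t k) / 2) / 2) / (\<bar>?s k x\<bar> powr q k)) =
      cot_sum N q t x / 2"
    unfolding cot_sum_def sum_divide_distrib using assms by (intro sum.cong) (auto simp: off_nodes_def)
  finally show ?thesis .
qed

section \<open>Cyclically ordered nodes\<close>

text \<open>The entry with index \<open>Suc N\<close> repeats the first node after a full turn, so that all
  \<open>N\<close> arcs of the circle have the form from \<open>t j\<close> to \<open>t (Suc j)\<close>.\<close>

definition cyclic_nodes :: "nat \<Rightarrow> (nat \<Rightarrow> real) \<Rightarrow> bool" where
  "cyclic_nodes N t \<longleftrightarrow> (\<forall>k\<in>{1..N}. t k \<le> t (Suc k)) \<and> t (Suc N) = t 1 + 2 * pi"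

lemma cyclic_nodes_mono:
  assumes "cyclic_nodes N t" "1 \<le> i" "i \<le> j" "j \<le> Suc N"
  shows "t i \<le> t j"
  using assms(3,4)
proof (induction j rule: dec_induct)
  case (step m)
  then have "t m \<le> t (Suc m)" using assms(1,2) by (auto simp: cyclic_nodes_def)
  with step show ?case by simp
qed simp

lemma cyclic_nodes_shift:
  assumes "cyclic_nodes N t"
  shows "cyclic_nodes N (\<lambda>k. t k + c)"
  using assms by (auto simp: cyclic_nodes_def)

lemma cyclic_nodes_diff_first:
  assumes t: "cyclic_nodes N t" and "k \<in> {1..Suc N}"
  shows "t k - t 1 \<in> {0..2*pi}"
  using cyclic_nodes_mono[OF t, of 1 k] cyclic_nodes_mono[OF t, of k "Suc N"] assms
  by (auto simp: cyclic_nodes_def)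

lemma arc_diff_node:
  assumes t: "cyclic_nodes N t" and i: "i \<in> {1..Suc N}" and j: "j \<in> {1..N}"
    and x: "x \<in> {t j<..<t (Suc j)}"
  shows "i \<le> j \<Longrightarrow> x - t i \<in> {0<..<2*pi}" and "j < i \<Longrightarrow> x - t i \<in> {-2*pi<..<0}"
proof -
  have "t i - t 1 \<in> {0..2*pi}" "t j - t 1 \<in> {0..2*pi}" "t (Suc j) - t 1 \<in> {0..2*pi}"
    using cyclic_nodes_diff_first[OF t, of i] cyclic_nodes_diff_first[OF t, of j]
      cyclic_nodes_diff_first[OF t, of "Suc j"] i j by auto
  moreover have "i \<le> j \<Longrightarrow> t i \<le> t j" "j < i \<Longrightarrow> t (Suc j) \<le> t i"
    using i j by (auto intro!: cyclic_nodes_mono[OF t])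
  ultimately show "i \<le> j \<Longrightarrow> x - t i \<in> {0<..<2*pi}" "j < i \<Longrightarrow> x - t i \<in> {-2*pi<..<0}"
    using x by auto
qed

lemma same_branch_arc:
  assumes "cyclic_nodes N t" "cyclic_nodes N w" "i \<in> {1..N}" "j \<in> {1..N}"
    and "x \<in> {t j<..<t (Suc j)}" "y \<in> {w j<..<w (Suc j)}"
  shows "same_branch (x - t i) (y - w i)"
  using arc_diff_node[OF assms(1) _ assms(4,5), of i] arc_diff_node[OF assms(2) _ assms(4,6), of i]
    assms(3)
  unfolding same_branch_def by (cases "i \<le> j") auto

lemma same_branch_arc_endpoints:
  assumes t: "cyclic_nodes N t" and ij: "i \<in> {1..N}" "j \<in> {1..N}" "i \<noteq> j"
    and x: "x \<in> {t i<..<t (Suc i)}"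
  shows "same_branch (x - t (Suc j)) (x - t j)"
  using arc_diff_node[OF t _ ij(1) x, of j] arc_diff_node[OF t _ ij(1) x, of "Suc j"] ij
  unfolding same_branch_def by (cases "i < j") auto

lemma off_nodes_arc:
  assumes "cyclic_nodes N t" "j \<in> {1..N}" "x \<in> {t j<..<t (Suc j)}"
  shows "off_nodes N t x"
  unfolding off_nodes_def using same_branch_arc[OF assms(1,1) _ assms(2,3,3)]
  by (blast dest: same_branch_sin_half_nonzero)

lemma sin_half_diff_distinct_arcs:
  assumes t: "cyclic_nodes N t" and ij: "i \<in> {1..N}" "j \<in> {1..N}" "i \<noteq> j"
    and x: "x \<in> {t i<..<t (Suc i)}" and y: "y \<in> {t j<..<t (Suc j)}"
  shows "sin ((y - x) / 2) \<noteq> 0"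
proof (rule sin_half_nonzero)
  have "i < j \<Longrightarrow> t (Suc i) \<le> t j" "j < i \<Longrightarrow> t (Suc j) \<le> t i"
    using ij by (auto intro!: cyclic_nodes_mono[OF t])
  then show "y - x \<noteq> 0"
    using x y ij(3) by (cases "i < j") auto
  have "x - t 1 \<in> {0<..<2*pi}" "y - t 1 \<in> {0<..<2*pi}"
    using arc_diff_node(1)[OF t _ _ x, of 1] arc_diff_node(1)[OF t _ _ y, of 1] ij by auto
  then show "\<bar>y - x\<bar> < 2 * pi" by auto
qed

lemma ex_arc_containing:
  fixes t :: "nat \<Rightarrow> real"
  assumes "i \<le> Suc N" "x \<in> {t i..<t (Suc N)}"
  shows "\<exists>j\<in>{i..N}. x \<in> {t j..<t (Suc j)}"
  using assms
proof (induction i rule: inc_induct)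
  case (step m)
  show ?case
  proof (cases "x < t (Suc m)")
    case True
    with step show ?thesis by (intro bexI[of _ m]) auto
  next
    case False
    then obtain j where "j \<in> {Suc m..N}" "x \<in> {t j..<t (Suc j)}"
      using step by auto
    then show ?thesis by (intro bexI[of _ j]) auto
  qed
qed simp

lemma sin_prod_arc_endpoints:
  assumes "cyclic_nodes N t" "j \<in> {1..N}"
  shows "sin_prod N q t (t j) = 0" "sin_prod N q t (t (Suc j)) = 0"
proof -
  have zero_at_node: "sin_prod N q t (t k) = 0" if "k \<in> {1..N}" for k
    using that unfolding sin_prod_def by (intro prod_zero bexI[of _ k]) auto
  show "sin_prod N q t (t j) = 0" using zero_at_node assms(2) .
  show "sin_prod N q t (t (Suc j)) = 0"
  proof (cases "j = N")
    case True
    then have "[t 1 = t (Suc j)] (rmod (2 * pi))"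
      using assms by (auto simp: cyclic_nodes_def rcong_altdef intro!: exI[of _ 1])
    then have "sin_prod N q t (t (Suc j)) = sin_prod N q t (t 1)"
      by (rule sin_prod_rcong[symmetric])
    then show ?thesis using zero_at_node[of 1] assms(2) by simp
  next
    case False
    then show ?thesis using zero_at_node[of "Suc j"] assms(2) by auto
  qed
qed

lemma ex_rcong_ivl:
  fixes x :: real
  obtains y where "y \<in> {a..<a + 2 * pi}" "[y = x] (rmod (2 * pi))"
proof
  let ?y = "a + (x - a) rmod (2 * pi)"
  show "?y \<in> {a..<a + 2 * pi}"
    using rmod_nonneg[of "2 * pi" "x - a"] rmod_less[of "2 * pi" "x - a"] by auto
  have "[(x - a) rmod (2 * pi) = x - a] (rmod (2 * pi))" by simp
  then have "[?y = a + (x - a)] (rmod (2 * pi))" by (intro rcong_add rcong_refl)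
  then show "[?y = x] (rmod (2 * pi))" by simp
qed

lemma ex_arc_sin_prod_eq:
  assumes t: "cyclic_nodes N t" and "N \<ge> 1"
  obtains j y where "j \<in> {1..N}" "y \<in> {t j..<t (Suc j)}" "sin_prod N q t y = sin_prod N q t x"
proof -
  obtain y where y: "y \<in> {t 1..<t 1 + 2 * pi}" "[y = x] (rmod (2 * pi))"
    by (rule ex_rcong_ivl)
  then obtain j where "j \<in> {1..N}" "y \<in> {t j..<t (Suc j)}"
    using ex_arc_containing[of 1 N y t] t by (auto simp: cyclic_nodes_def)
  then show thesis using sin_prod_rcong[OF y(2)] that by blast
qed

definition proper_arcs :: "nat \<Rightarrow> (nat \<Rightarrow> real) \<Rightarrow> nat set" where
  "proper_arcs N t = {j \<in> {1..N}. t j < t (Suc j)}"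

lemma proper_arcsD:
  assumes "j \<in> proper_arcs N t"
  shows "j \<in> {1..N}" "t j < t (Suc j)"
  using assms by (auto simp: proper_arcs_def)

lemma ex_proper_arc_rcong:
  assumes t: "cyclic_nodes N t" and i: "i \<in> {1..N}"
  shows "\<exists>j\<in>proper_arcs N t. [t j = t i] (rmod (2 * pi))"
proof -
  define k where "k = (if t i < t (Suc N) then i else 1)"
  have "t i \<le> t (Suc N)" using cyclic_nodes_mono[OF t, of i "Suc N"] i by auto
  then have "[t k = t i] (rmod (2 * pi))" and "k \<in> {1..N}" and "t k \<in> {t k..<t (Suc N)}"
    using t i by (auto simp: k_def cyclic_nodes_def rcong_altdef intro!: exI[of _ 1])
  moreover from this obtain j where "j \<in> {k..N}" "t k \<in> {t j..<t (Suc j)}"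
    using ex_arc_containing[of k N "t k" t] by auto
  moreover from this have "t k \<le> t j"
    using \<open>k \<in> {1..N}\<close> by (intro cyclic_nodes_mono[OF t]) auto
  ultimately show ?thesis
    by (intro bexI[of _ j]) (auto simp: proper_arcs_def)
qed

lemma ex_proper_arc_representatives:
  assumes "cyclic_nodes N t"
  obtains p where "\<And>i. i \<in> {1..N} \<Longrightarrow> p i \<in> proper_arcs N t"
    and "\<And>i. i \<in> {1..N} \<Longrightarrow> [t (p i) = t i] (rmod (2 * pi))"
    and "\<And>i. i \<in> proper_arcs N t \<Longrightarrow> p i = i"
proof -
  have "\<exists>p. \<forall>i\<in>{1..N}. p i \<in> proper_arcs N t \<and> [t (p i) = t i] (rmod (2 * pi)) \<and>
      (i \<in> proper_arcs N t \<longrightarrow> p i = i)"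
    using ex_proper_arc_rcong[OF assms] by (intro bchoice) (metis rcong_refl)
  then show thesis using that proper_arcsD(1) by metis
qed

section \<open>Positive weights\<close>

locale positive_weights =
  fixes N :: nat and q :: "nat \<Rightarrow> real"
  assumes weight_pos: "k \<in> {1..N} \<Longrightarrow> q k > 0"
begin

lemma sin_prod_le_1: "sin_prod N q t x \<le> 1"
  unfolding sin_prod_def
  by (intro prod_le_1) (auto simp: less_imp_le weight_pos powr_le1)

lemma tendsto_sin_prod:
  assumes "\<And>k. k \<in> {1..N} \<Longrightarrow> ((\<lambda>p. s p k) \<longlongrightarrow> t k) F" and "(y \<longlongrightarrow> x) F"
  shows "((\<lambda>p. sin_prod N q (s p) (y p)) \<longlongrightarrow> sin_prod N q t x) F"
  unfolding sin_prod_def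
proof (intro tendsto_prod tendsto_powr' tendsto_const disjI2 conjI weight_pos)
  fix k assume "k \<in> {1..N}"
  then show "((\<lambda>p. \<bar>sin ((y p - s p k) / 2)\<bar>) \<longlongrightarrow> \<bar>sin ((x - t k) / 2)\<bar>) F"
    using assms by (intro tendsto_rabs isCont_tendsto_compose[OF isCont_sin]
        tendsto_divide tendsto_diff tendsto_const) auto
qed auto

lemma continuous_on_sin_prod:
  assumes "\<And>k. k \<in> {1..N} \<Longrightarrow> continuous_on S (\<lambda>p. s p k)" and "continuous_on S y"
  shows "continuous_on S (\<lambda>p. sin_prod N q (s p) (y p))"
  using assms unfolding continuous_on_def by (intro ballI tendsto_sin_prod) auto

lemma ln_sin_prod_below_tangent:
  assumes branch: "\<And>k. k \<in> {1..N} \<Longrightarrow> same_branch (x - t k) (y - w k)"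
    and differ: "l \<in> {1..N}" "x - t l \<noteq> y - w l"
  shows "ln (sin_prod N q w y) < ln (sin_prod N q t x) +
    ((y - x) * cot_sum N q t x - (\<Sum>k = 1..N. q k * cot ((x - t k) / 2) * (w k - t k))) / 2"
proof -
  let ?u = "\<lambda>k. x - t k" and ?v = "\<lambda>k. y - w k"
  let ?tangent = "\<lambda>k. log_sin_half (?u k) + cot (?u k / 2) / 2 * (?v k - ?u k)"
  have off: "off_nodes N t x" "off_nodes N w y"
    using same_branch_sin_half_nonzero[OF branch] by (simp_all add: off_nodes_def)
  have below: "?u k \<noteq> ?v k \<Longrightarrow> log_sin_half (?v k) < ?tangent k" if "k \<in> {1..N}" for k
    using log_sin_half_below_tangent[OF branch[OF that]] .
  have "ln (sin_prod N q w y) = (\<Sum>k = 1..N. q k * log_sin_half (?v k))"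
    by (rule ln_sin_prod[OF off(2)])
  also have "\<dots> < (\<Sum>k = 1..N. q k * ?tangent k)"
  proof (rule sum_strict_mono_ex1)
    show "\<forall>k\<in>{1..N}. q k * log_sin_half (?v k) \<le> q k * ?tangent k"
    proof
      fix k assume k: "k \<in> {1..N}"
      show "q k * log_sin_half (?v k) \<le> q k * ?tangent k"
        using below[OF k] weight_pos[OF k] by (intro mult_left_mono) (cases "?u k = ?v k", auto)
    qed
    show "\<exists>k\<in>{1..N}. q k * log_sin_half (?v k) < q k * ?tangent k"
      using below[OF differ] weight_pos[OF differ(1)] differ(1)
      by (intro bexI[of _ l] mult_strict_left_mono)
  qed simp
  also have "\<dots> = (\<Sum>k = 1..N. q k * log_sin_half (?u k) + ((y - x) * (q k * cot (?u k / 2)) -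
      q k * cot (?u k / 2) * (w k - t k)) / 2)"
    by (intro sum.cong refl) (simp add: field_simps)
  also have "\<dots> = ln (sin_prod N q t x) +
      ((y - x) * cot_sum N q t x - (\<Sum>k = 1..N. q k * cot (?u k / 2) * (w k - t k))) / 2"
    by (simp add: ln_sin_prod[OF off(1)] cot_sum_def sum.distrib sum_subtractf sum_distrib_left
        flip: sum_divide_distrib)
  finally show ?thesis .
qed

lemma ex_critical_point:
  assumes t: "cyclic_nodes N t" and j: "j \<in> {1..N}" and "t j < t (Suc j)"
  obtains z where "z \<in> {t j<..<t (Suc j)}" "cot_sum N q t z = 0"
proof -
  have off: "off_nodes N t x" if "t j < x" "x < t (Suc j)" for x
    using that by (intro off_nodes_arc[OF t j]) auto
  have "continuous_on {t j..t (Suc j)} (sin_prod N q t)"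
    by (intro continuous_on_sin_prod[where s = "\<lambda>_. t" and y = "\<lambda>x. x"] continuous_intros)
  moreover have "(sin_prod N q t has_derivative (*) (sin_prod N q t x * (cot_sum N q t x / 2))) (at x)"
    if "t j < x" "x < t (Suc j)" for x
    using sin_prod_has_derivative[OF off[OF that]] by (rule has_field_derivative_imp_has_derivative)
  moreover have "sin_prod N q t (t j) = sin_prod N q t (t (Suc j))"
    by (simp add: sin_prod_arc_endpoints[OF t j])
  ultimately obtain z where z: "t j < z" "z < t (Suc j)"
    and deriv_zero: "(*) (sin_prod N q t z * (cot_sum N q t z / 2)) = (\<lambda>_. 0)"
    using Rolle_deriv[OF \<open>t j < t (Suc j)\<close>, of "sin_prod N q t"
        "\<lambda>x. (*) (sin_prod N q t x * (cot_sum N q t x / 2))"] by metis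
  have "sin_prod N q t z * cot_sum N q t z = 0"
    using fun_cong[OF deriv_zero, of 1] by simp
  then have "cot_sum N q t z = 0"
    using off[OF z] by (auto simp flip: sin_prod_pos_iff[of N q])
  with z that show thesis by auto
qed

section \<open>Comparison with equioscillating nodes\<close>

lemma critical_points_dual_weights:
  assumes t: "cyclic_nodes N t"
    and z: "\<And>j. j \<in> proper_arcs N t \<Longrightarrow> z j \<in> {t j<..<t (Suc j)}"
    and critical: "\<And>j. j \<in> proper_arcs N t \<Longrightarrow> cot_sum N q t (z j) = 0"
  obtains c where "\<And>j. j \<in> proper_arcs N t \<Longrightarrow> c j > 0"
    and "\<And>i. i \<in> {1..N} \<Longrightarrow> (\<Sum>j\<in>proper_arcs N t. c j * cot ((z j - t i) / 2)) = 0"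
proof -
  let ?J = "proper_arcs N t"
  have "finite ?J" by (simp add: proper_arcs_def)
  obtain p where p_mem: "\<And>i. i \<in> {1..N} \<Longrightarrow> p i \<in> ?J"
    and p_rcong: "\<And>i. i \<in> {1..N} \<Longrightarrow> [t (p i) = t i] (rmod (2 * pi))"
    and p_proper: "\<And>i. i \<in> ?J \<Longrightarrow> p i = i"
    using ex_proper_arc_representatives[OF t] by blast
  have cot_p: "cot ((x - t (p i)) / 2) = cot ((x - t i) / 2)" if "i \<in> {1..N}" for x i
    using p_rcong[OF that] by (intro cot_half_rcong) simp
  define \<rho> where "\<rho> k = (\<Sum>i | i \<in> {1..N} \<and> p i = k. q i)" for k
  have "\<rho> k > 0" if "k \<in> ?J" for k
    unfolding \<rho>_def using proper_arcsD(1)[OF that] p_proper[OF that] weight_pos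
    by (intro sum_pos) auto
  moreover have "sin ((z j - t k) / 2) \<noteq> 0" if "j \<in> ?J" "k \<in> ?J" for j k
    using off_nodes_arc[OF t proper_arcsD(1)[OF that(1)] z[OF that(1)]] proper_arcsD(1)[OF that(2)]
    by (simp add: off_nodes_def)
  moreover have "sin ((z j - z i) / 2) \<noteq> 0" if "i \<in> ?J" "j \<in> ?J" "i \<noteq> j" for i j
    using sin_half_diff_distinct_arcs[OF t proper_arcsD(1) proper_arcsD(1)] z that by blast
  moreover have "(\<Sum>k\<in>?J. \<rho> k * cot ((z j - t k) / 2)) = 0" if "j \<in> ?J" for j
  proof -
    have "(\<Sum>k\<in>?J. \<rho> k * cot ((z j - t k) / 2)) =
        (\<Sum>k\<in>?J. \<Sum>i | i \<in> {1..N} \<and> p i = k. q i * cot ((z j - t i) / 2))"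
      unfolding \<rho>_def sum_distrib_right by (intro sum.cong refl) (auto simp flip: cot_p)
    also have "\<dots> = cot_sum N q t (z j)"
      unfolding cot_sum_def using \<open>finite ?J\<close> p_mem by (intro sum.group) auto
    finally show ?thesis using critical[OF that] by simp
  qed
  ultimately obtain c where c_pos: "\<And>j. j \<in> ?J \<Longrightarrow> c j > 0"
    and c_orth: "\<And>k. k \<in> ?J \<Longrightarrow> (\<Sum>j\<in>?J. c j * cot ((z j - t k) / 2)) = 0"
    using cot_critical_points_dual_weights[OF \<open>finite ?J\<close>, of \<rho> z t] by blast
  have "(\<Sum>j\<in>?J. c j * cot ((z j - t i) / 2)) = 0" if "i \<in> {1..N}" for i
    using c_orth[OF p_mem[OF that]] by (simp add: cot_p[OF that])
  with c_pos show thesis by (rule that)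
qed

definition equioscillating :: "(nat \<Rightarrow> real) \<Rightarrow> real \<Rightarrow> bool" where
  "equioscillating t M \<longleftrightarrow> cyclic_nodes N t \<and> (\<forall>x. sin_prod N q t x \<le> M) \<and>
     (\<forall>j\<in>{1..N}. \<exists>x\<in>{t j<..<t (Suc j)}. sin_prod N q t x = M)"

lemma critical_point_linear_form_neg:
  assumes t: "cyclic_nodes N t" and w: "cyclic_nodes N w" and j: "j \<in> {1..N}"
    and z: "z \<in> {t j<..<t (Suc j)}" "cot_sum N q t z = 0" and y: "y \<in> {w j<..<w (Suc j)}"
    and values_le: "sin_prod N q t z \<le> sin_prod N q w y"
    and centred: "t 1 + t N = w 1 + w N" and differ: "l \<in> {1..N}" "t l \<noteq> w l"
  shows "(\<Sum>k = 1..N. q k * cot ((z - t k) / 2) * (w k - t k)) < 0"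
proof -
  have "\<exists>k\<in>{1..N}. z - t k \<noteq> y - w k"
  proof (rule ccontr)
    assume "\<not> ?thesis"
    then have "z - t k = y - w k" if "k \<in> {1..N}" for k using that by blast
    from this[of 1] this[of N] this[of l] show False using centred differ by auto
  qed
  then obtain k where "k \<in> {1..N}" "z - t k \<noteq> y - w k" by blast
  then have "ln (sin_prod N q w y) < ln (sin_prod N q t z) +
      ((y - z) * cot_sum N q t z - (\<Sum>k = 1..N. q k * cot ((z - t k) / 2) * (w k - t k))) / 2"
    by (intro ln_sin_prod_below_tangent same_branch_arc[OF t w _ j z(1) y])
  moreover have "ln (sin_prod N q t z) \<le> ln (sin_prod N q w y)"
    using values_le off_nodes_arc[OF t j z(1)] by (intro ln_mono) (auto simp: sin_prod_pos_iff)
  ultimately show ?thesis using z(2) by simp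
qed

lemma sin_prod_above_equioscillation:
  assumes w: "equioscillating w M" and t: "cyclic_nodes N t"
    and centred: "t 1 + t N = w 1 + w N" and differ: "l \<in> {1..N}" "t l \<noteq> w l"
  shows "\<exists>x. M < sin_prod N q t x"
proof (rule ccontr)
  assume "\<not> ?thesis"
  then have below: "sin_prod N q t x \<le> M" for x by (simp add: not_less)
  let ?J = "proper_arcs N t"
  have cyclic_w: "cyclic_nodes N w" using w by (simp add: equioscillating_def)
  have "\<exists>z. \<forall>j\<in>?J. z j \<in> {t j<..<t (Suc j)} \<and> cot_sum N q t (z j) = 0"
    by (intro bchoice) (metis ex_critical_point[OF t] proper_arcsD)
  then obtain z where z: "\<And>j. j \<in> ?J \<Longrightarrow> z j \<in> {t j<..<t (Suc j)}"
    and critical: "\<And>j. j \<in> ?J \<Longrightarrow> cot_sum N q t (z j) = 0"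
    by blast
  obtain c where c_pos: "\<And>j. j \<in> ?J \<Longrightarrow> c j > 0"
    and c_orth: "\<And>i. i \<in> {1..N} \<Longrightarrow> (\<Sum>j\<in>?J. c j * cot ((z j - t i) / 2)) = 0"
    using critical_points_dual_weights[OF t z critical] by blast
  define L where "L j = (\<Sum>k = 1..N. q k * cot ((z j - t k) / 2) * (w k - t k))" for j
  have L_neg: "L j < 0" if j: "j \<in> ?J" for j
  proof -
    note j_index = proper_arcsD(1)[OF j]
    then obtain y where y: "y \<in> {w j<..<w (Suc j)}" "sin_prod N q w y = M"
      using w unfolding equioscillating_def by blast
    have "sin_prod N q t (z j) \<le> sin_prod N q w y" using below y(2) by simp
    then show ?thesis
      unfolding L_def
      by (rule critical_point_linear_form_neg[OF t cyclic_w j_index z[OF j] critical[OF j] y(1)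
            _ centred differ])
  qed
  have "?J \<noteq> {}" using ex_proper_arc_rcong[OF t differ(1)] by blast
  then have "(\<Sum>j\<in>?J. c j * - L j) > 0"
    using c_pos L_neg by (intro sum_pos mult_pos_pos) (auto simp: proper_arcs_def)
  moreover have "(\<Sum>j\<in>?J. c j * L j) =
      (\<Sum>k = 1..N. q k * (w k - t k) * (\<Sum>j\<in>?J. c j * cot ((z j - t k) / 2)))"
    unfolding L_def sum_distrib_left by (subst sum.swap) (simp add: mult_ac)
  ultimately show False by (simp add: c_orth sum_negf)
qed

section \<open>Maximizing the smallest arc maximum\<close>

definition arcs_reach :: "(nat \<Rightarrow> real) \<Rightarrow> real \<Rightarrow> bool" where
  "arcs_reach t m \<longleftrightarrow> (\<forall>j\<in>{1..N}. \<exists>x\<in>{t j..t (Suc j)}. m \<le> sin_prod N q t x)"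

definition maximin_nodes :: "(nat \<Rightarrow> real) \<Rightarrow> real \<Rightarrow> bool" where
  "maximin_nodes t M \<longleftrightarrow> cyclic_nodes N t \<and> arcs_reach t M \<and>
     (\<forall>s m. cyclic_nodes N s \<and> arcs_reach s m \<longrightarrow> m \<le> M)"

lemma ex_arcs_reach_greater:
  assumes "\<And>j. j \<in> {1..N} \<Longrightarrow> \<exists>x\<in>{t j..t (Suc j)}. M < sin_prod N q t x"
  shows "\<exists>m>M. arcs_reach t m"
proof -
  have "\<exists>x. \<forall>j\<in>{1..N}. x j \<in> {t j..t (Suc j)} \<and> M < sin_prod N q t (x j)"
    using assms by (intro bchoice) blast
  then obtain x where x: "\<And>j. j \<in> {1..N} \<Longrightarrow> x j \<in> {t j..t (Suc j)} \<and> M < sin_prod N q t (x j)"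
    by blast
  define m where "m = Min (insert (M + 1) ((\<lambda>j. sin_prod N q t (x j)) ` {1..N}))"
  have "m > M" using x by (simp add: m_def)
  moreover have "m \<le> sin_prod N q t (x j)" if "j \<in> {1..N}" for j
    unfolding m_def using that by (intro Min_le) auto
  ultimately show ?thesis unfolding arcs_reach_def using x by blast
qed

lemma ex_cyclic_nodes_arcs_reach_pos:
  assumes "N \<ge> 1"
  shows "\<exists>t m. cyclic_nodes N t \<and> arcs_reach t m \<and> m > 0"
proof -
  define t where "t k = 2 * pi * (real k - 1) / real N" for k
  have t_strict: "t k < t (Suc k)" for k
    using assms by (simp add: t_def divide_strict_right_mono)
  have t_last: "t (Suc N) = t 1 + 2 * pi"
    using assms by (simp add: t_def)
  then have t: "cyclic_nodes N t"
    using t_strict by (simp add: cyclic_nodes_def less_imp_le)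
  have "\<exists>m>0. arcs_reach t m"
  proof (rule ex_arcs_reach_greater)
    fix j assume j: "j \<in> {1..N}"
    have "(t j + t (Suc j)) / 2 \<in> {t j<..<t (Suc j)}" using t_strict[of j] by auto
    then show "\<exists>x\<in>{t j..t (Suc j)}. 0 < sin_prod N q t x"
      unfolding sin_prod_pos_iff using off_nodes_arc[OF t j]
      by (intro bexI[of _ "(t j + t (Suc j)) / 2"]) auto
  qed
  with t show ?thesis by blast
qed

text \<open>Carrying the sample points along makes the set of attained levels visibly closed, so that the
  continuity of the arc maxima is not needed.\<close>

definition normalized_samples :: "((nat \<Rightarrow> real) \<times> (nat \<Rightarrow> real) \<times> real) set" where
  "normalized_samples = {(t, x, m). t \<in> UNIV \<rightarrow> {0..2*pi} \<and> x \<in> UNIV \<rightarrow> {0..2*pi} \<and> m \<in> {0..1} \<and>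
     cyclic_nodes N t \<and> (\<forall>j\<in>{1..N}. x j \<in> {t j..t (Suc j)} \<and> m \<le> sin_prod N q t (x j))}"

lemma compact_normalized_samples: "compact normalized_samples"
proof -
  let ?cube = "UNIV \<rightarrow> {0..2*pi} :: (nat \<Rightarrow> real) set"
  have "compactin (product_topology (\<lambda>_. euclidean) UNIV)
      (PiE UNIV (\<lambda>_. {0..2*pi}) :: (nat \<Rightarrow> real) set)"
    unfolding compactin_PiE by simp
  then have "compact ?cube"
    by (simp add: euclidean_product_topology PiE_UNIV_domain)
  define K :: "((nat \<Rightarrow> real) \<times> (nat \<Rightarrow> real) \<times> real) set" where
    "K = {p. (\<forall>k\<in>{1..N}. fst p k \<le> fst p (Suc k)) \<and> fst p (Suc N) = fst p 1 + 2 * pi \<and>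
       (\<forall>j\<in>{1..N}. fst p j \<le> fst (snd p) j \<and> fst (snd p) j \<le> fst p (Suc j) \<and>
         snd (snd p) \<le> sin_prod N q (fst p) (fst (snd p) j))}"
  have coord: "continuous_on UNIV (\<lambda>p :: (nat \<Rightarrow> real) \<times> (nat \<Rightarrow> real) \<times> real. fst p k)"
    "continuous_on UNIV (\<lambda>p :: (nat \<Rightarrow> real) \<times> (nat \<Rightarrow> real) \<times> real. fst (snd p) k)" for k
    by (rule continuous_on_product_then_coordinatewise, intro continuous_intros)+
  have level: "continuous_on UNIV (\<lambda>p :: (nat \<Rightarrow> real) \<times> (nat \<Rightarrow> real) \<times> real. snd (snd p))"
    by (intro continuous_intros)
  have "closed K"
    unfolding K_def Ball_def
    by (intro closed_Collect_conj closed_Collect_all closed_Collect_imp closed_Collect_le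
        closed_Collect_eq continuous_on_add continuous_on_const continuous_on_sin_prod
        coord level) auto
  then have "compact (?cube \<times> ?cube \<times> {0..1} \<inter> K)"
    by (intro compact_Int_closed compact_Times \<open>compact ?cube\<close>) auto
  also have "?cube \<times> ?cube \<times> {0..1} \<inter> K = normalized_samples"
    by (auto simp: normalized_samples_def K_def cyclic_nodes_def)
  finally show ?thesis .
qed

lemma normalized_sample_of_arcs_reach:
  assumes t: "cyclic_nodes N t" and reach: "arcs_reach t m" and "m \<ge> 0" "N \<ge> 1"
  shows "\<exists>s x. (s, x, m) \<in> normalized_samples"
proof -
  have "\<exists>x. \<forall>j\<in>{1..N}. x j \<in> {t j..t (Suc j)} \<and> m \<le> sin_prod N q t (x j)"
    using reach unfolding arcs_reach_def by (intro bchoice) blast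
  then obtain x where x: "\<And>j. j \<in> {1..N} \<Longrightarrow> x j \<in> {t j..t (Suc j)}"
    and m: "\<And>j. j \<in> {1..N} \<Longrightarrow> m \<le> sin_prod N q t (x j)"
    by blast
  define s where "s k = (if k \<in> {1..Suc N} then t k - t 1 else 0)" for k
  define y where "y j = (if j \<in> {1..N} then x j - t 1 else 0)" for j
  have s_range: "t k - t 1 \<in> {0..2*pi}" if "k \<in> {1..Suc N}" for k
    using cyclic_nodes_diff_first[OF t that] .
  have y_range: "x j - t 1 \<in> {0..2*pi}" if "j \<in> {1..N}" for j
    using s_range[of j] s_range[of "Suc j"] x[OF that] that by auto
  have shift: "sin_prod N q s (x j - t 1) = sin_prod N q t (x j)" for j
    using sin_prod_shift[of N q t "- t 1" "x j"] sin_prod_cong[of N s "\<lambda>k. t k - t 1" q]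
    by (simp add: s_def)
  have "m \<le> 1" using m[of 1] sin_prod_le_1[of t "x 1"] \<open>N \<ge> 1\<close> by force
  moreover have "cyclic_nodes N s"
    using t \<open>N \<ge> 1\<close> by (auto simp: cyclic_nodes_def s_def)
  moreover have "m \<le> sin_prod N q s (y j)" if "j \<in> {1..N}" for j
    using m[OF that] that by (simp add: y_def shift[unfolded One_nat_def])
  ultimately have "(s, y, m) \<in> normalized_samples"
    using \<open>m \<ge> 0\<close> s_range y_range x by (auto simp: normalized_samples_def) (auto simp: s_def y_def)
  then show ?thesis by blast
qed

lemma ex_maximin_nodes:
  assumes "N \<ge> 1"
  obtains w M where "maximin_nodes w M" "M > 0"
proof -
  obtain t m where t: "cyclic_nodes N t" "arcs_reach t m" "m > 0"
    using ex_cyclic_nodes_arcs_reach_pos[OF assms] by blast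
  have "continuous_on normalized_samples (\<lambda>p. snd (snd p))"
    by (intro continuous_intros)
  moreover have "normalized_samples \<noteq> {}"
    using normalized_sample_of_arcs_reach[OF t(1,2)] t(3) assms by force
  ultimately obtain w x M where w: "(w, x, M) \<in> normalized_samples"
    and M_max: "\<And>s y m. (s, y, m) \<in> normalized_samples \<Longrightarrow> m \<le> M"
    using continuous_attains_sup[OF compact_normalized_samples] by force
  have le_M: "m \<le> M" if "cyclic_nodes N s" "arcs_reach s m" for s m
  proof (cases "m \<ge> 0")
    case True
    then show ?thesis using normalized_sample_of_arcs_reach[OF that _ assms] M_max by blast
  next
    case False
    then show ?thesis using w by (auto simp: normalized_samples_def)
  qed
  have "maximin_nodes w M"
    using w le_M by (auto simp: maximin_nodes_def normalized_samples_def arcs_reach_def)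
  moreover have "M > 0" using le_M[OF t(1,2)] t(3) by linarith
  ultimately show thesis by (rule that)
qed

definition next_node :: "nat \<Rightarrow> nat" where
  "next_node j = (if j = N then 1 else Suc j)"

lemma next_node:
  assumes "N \<ge> 2" "j \<in> {1..N}"
  shows "next_node j \<in> {1..N}" "next_node j \<noteq> j"
  using assms by (auto simp: next_node_def)

lemma next_node_rcong:
  assumes "cyclic_nodes N t"
  shows "[t (next_node j) = t (Suc j)] (rmod (2 * pi))"
  using assms by (auto simp: next_node_def cyclic_nodes_def rcong_altdef intro!: exI[of _ 1])

text \<open>The endpoints of an arc move inwards at speeds inverse to their weights. To first order the
  logarithm of the product then changes by a difference of two cotangents, whose sign is known
  outside that arc.\<close>

definition shrink_arc :: "nat \<Rightarrow> (nat \<Rightarrow> real) \<Rightarrow> real \<Rightarrow> nat \<Rightarrow> real" where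
  "shrink_arc j t \<epsilon> = (let s = t(j := t j + \<epsilon> / q j,
       next_node j := t (next_node j) - \<epsilon> / q (next_node j)) in s(Suc N := s 1 + 2 * pi))"

lemma shrink_arc_apply:
  assumes "N \<ge> 2" "j \<in> {1..N}" "k \<in> {1..N}"
  shows "shrink_arc j t \<epsilon> k =
    t k + \<epsilon> * (if k = j then 1 / q k else if k = next_node j then - 1 / q k else 0)"
  using next_node[OF assms(1,2)] assms by (auto simp: shrink_arc_def Let_def)

lemma shrink_arc_last: "N \<ge> 1 \<Longrightarrow> shrink_arc j t \<epsilon> (Suc N) = shrink_arc j t \<epsilon> 1 + 2 * pi"
  by (simp add: shrink_arc_def Let_def)

lemma tendsto_shrink_arc:
  assumes "N \<ge> 2" "j \<in> {1..N}" "cyclic_nodes N t" and k: "k \<in> {1..Suc N}"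
  shows "((\<lambda>\<epsilon>. shrink_arc j t \<epsilon> k) \<longlongrightarrow> t k) (at_right 0)"
proof -
  have tendsto: "((\<lambda>\<epsilon>. shrink_arc j t \<epsilon> k) \<longlongrightarrow> t k) (at_right 0)" if "k \<in> {1..N}" for k
  proof -
    have "((\<lambda>\<epsilon>. t k + \<epsilon> * c) \<longlongrightarrow> t k + 0 * c) (at_right 0)" for c
      by (intro tendsto_intros)
    then show ?thesis using that assms(1,2) by (simp add: shrink_arc_apply)
  qed
  show ?thesis
  proof (cases "k = Suc N")
    case True
    then show ?thesis
      using tendsto[of 1] assms by (auto simp: shrink_arc_last cyclic_nodes_def intro!: tendsto_intros)
  next
    case False
    then show ?thesis using tendsto k by simp
  qed
qed

lemma sin_prod_less_shrink_arc:
  assumes N: "N \<ge> 2" and ij: "i \<in> {1..N}" "j \<in> {1..N}" "i \<noteq> j" and "\<epsilon> > 0"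
    and t: "cyclic_nodes N t" "y \<in> {t i<..<t (Suc i)}"
    and s: "cyclic_nodes N (shrink_arc j t \<epsilon>)" "y \<in> {shrink_arc j t \<epsilon> i<..<shrink_arc j t \<epsilon> (Suc i)}"
  shows "sin_prod N q t y < sin_prod N q (shrink_arc j t \<epsilon>) y"
proof -
  let ?b = "next_node j" and ?s = "shrink_arc j t \<epsilon>"
  let ?cot = "\<lambda>k. cot ((y - ?s k) / 2)"
  note b = next_node[OF N ij(2)]
  have "q j > 0" "q ?b > 0" using weight_pos ij(2) b(1) by blast+
  have "?cot ?b = ?cot (Suc j)"
    using next_node_rcong[OF s(1), of j] by (intro cot_half_rcong) simp
  moreover have "?s j \<le> ?s (Suc j)" using ij(2) s(1) by (auto simp: cyclic_nodes_def)
  ultimately have cot_le: "?cot j \<le> ?cot ?b"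
    using cot_half_strict_antimono[OF same_branch_arc_endpoints[OF s(1) ij s(2)]]
    by (cases "?s j = ?s (Suc j)") auto
  have "(\<Sum>k = 1..N. q k * ?cot k * (t k - ?s k)) =
      (\<Sum>k = 1..N. (if k = ?b then \<epsilon> * ?cot ?b else 0) - (if k = j then \<epsilon> * ?cot j else 0))"
    using b(2) \<open>q j > 0\<close> \<open>q ?b > 0\<close> by (intro sum.cong refl) (auto simp: shrink_arc_apply[OF N ij(2)])
  also have "\<dots> = \<epsilon> * (?cot ?b - ?cot j)"
    using b(1) ij(2) by (simp add: sum_subtractf right_diff_distrib)
  also have "\<dots> \<ge> 0" using cot_le \<open>\<epsilon> > 0\<close> by simp
  finally have first_order: "(\<Sum>k = 1..N. q k * ?cot k * (t k - ?s k)) \<ge> 0" .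
  have "?s j \<noteq> t j"
    using \<open>q j > 0\<close> \<open>\<epsilon> > 0\<close> by (simp add: shrink_arc_apply[OF N ij(2,2)])
  then have "ln (sin_prod N q t y) < ln (sin_prod N q ?s y) +
      ((y - y) * cot_sum N q ?s y - (\<Sum>k = 1..N. q k * ?cot k * (t k - ?s k))) / 2"
    by (intro ln_sin_prod_below_tangent[OF _ ij(2)]
        same_branch_arc[OF s(1) t(1) _ ij(1) s(2) t(2)]) auto
  then have "ln (sin_prod N q t y) < ln (sin_prod N q ?s y)" using first_order by simp
  moreover have "sin_prod N q t y > 0" "sin_prod N q ?s y > 0"
    unfolding sin_prod_pos_iff
    using off_nodes_arc[OF t(1) ij(1) t(2)] off_nodes_arc[OF s(1) ij(1) s(2)] .
  ultimately show ?thesis by simp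
qed

lemma ex_shrink_arc_near:
  assumes N: "N \<ge> 2" and j: "j \<in> {1..N}" and t: "cyclic_nodes N t"
    and y: "\<And>i. i \<in> {1..N} \<Longrightarrow> y i \<in> {t i<..<t (Suc i)}" and "M < sin_prod N q t x"
  obtains \<epsilon> where "\<epsilon> > 0" "cyclic_nodes N (shrink_arc j t \<epsilon>)" "M < sin_prod N q (shrink_arc j t \<epsilon>) x"
    "\<And>i. i \<in> {1..N} \<Longrightarrow> y i \<in> {shrink_arc j t \<epsilon> i<..<shrink_arc j t \<epsilon> (Suc i)}"
proof -
  note tendsto = tendsto_shrink_arc[OF N j t]
  have "\<forall>\<^sub>F \<epsilon> in at_right 0. \<forall>i\<in>{1..N}. shrink_arc j t \<epsilon> i < y i \<and> y i < shrink_arc j t \<epsilon> (Suc i)"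
    using y by (intro eventually_ball_finite ballI eventually_conj
        order_tendstoD(2)[OF tendsto] order_tendstoD(1)[OF tendsto]) auto
  moreover have "((\<lambda>\<epsilon>. sin_prod N q (shrink_arc j t \<epsilon>) x) \<longlongrightarrow> sin_prod N q t x) (at_right 0)"
    by (intro tendsto_sin_prod tendsto tendsto_const) auto
  then have "\<forall>\<^sub>F \<epsilon> in at_right 0. M < sin_prod N q (shrink_arc j t \<epsilon>) x"
    using \<open>M < sin_prod N q t x\<close> by (rule order_tendstoD(1))
  moreover have "\<forall>\<^sub>F \<epsilon> in at_right (0::real). \<epsilon> > 0"
    by (rule eventually_at_right_less)
  ultimately have "\<forall>\<^sub>F \<epsilon> in at_right 0.
      (\<forall>i\<in>{1..N}. shrink_arc j t \<epsilon> i < y i \<and> y i < shrink_arc j t \<epsilon> (Suc i)) \<and>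
      M < sin_prod N q (shrink_arc j t \<epsilon>) x \<and> \<epsilon> > 0"
    by eventually_elim auto
  then obtain \<epsilon> where arc: "\<And>i. i \<in> {1..N} \<Longrightarrow> y i \<in> {shrink_arc j t \<epsilon> i<..<shrink_arc j t \<epsilon> (Suc i)}"
    and "M < sin_prod N q (shrink_arc j t \<epsilon>) x" "\<epsilon> > 0"
    using eventually_happens[of _ "at_right (0::real)"] by fastforce
  moreover have "shrink_arc j t \<epsilon> i \<le> shrink_arc j t \<epsilon> (Suc i)" if "i \<in> {1..N}" for i
    using arc[OF that] by auto
  then have "cyclic_nodes N (shrink_arc j t \<epsilon>)"
    using N by (simp add: cyclic_nodes_def shrink_arc_last)
  ultimately show thesis using that by blast
qed

lemma ex_cyclic_nodes_arcs_reach_greater: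
  assumes N: "N \<ge> 2" and t: "cyclic_nodes N t"
    and y: "\<And>i. i \<in> {1..N} \<Longrightarrow> y i \<in> {t i<..<t (Suc i)}"
    and all_ge: "\<And>i. i \<in> {1..N} \<Longrightarrow> M \<le> sin_prod N q t (y i)"
    and j: "j \<in> {1..N}" and greater: "M < sin_prod N q t (y j)"
  shows "\<exists>s m. cyclic_nodes N s \<and> arcs_reach s m \<and> m > M"
proof -
  obtain \<epsilon> where "\<epsilon> > 0" and s: "cyclic_nodes N (shrink_arc j t \<epsilon>)"
    and greater_s: "M < sin_prod N q (shrink_arc j t \<epsilon>) (y j)"
    and y_s: "\<And>i. i \<in> {1..N} \<Longrightarrow> y i \<in> {shrink_arc j t \<epsilon> i<..<shrink_arc j t \<epsilon> (Suc i)}"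
    using ex_shrink_arc_near[OF N j t y greater] by blast
  have "M < sin_prod N q (shrink_arc j t \<epsilon>) (y i)" if i: "i \<in> {1..N}" for i
  proof (cases "i = j")
    case True
    then show ?thesis using greater_s by simp
  next
    case False
    have "M \<le> sin_prod N q t (y i)" by (rule all_ge[OF i])
    also have "\<dots> < sin_prod N q (shrink_arc j t \<epsilon>) (y i)"
      by (rule sin_prod_less_shrink_arc[OF N i j False \<open>\<epsilon> > 0\<close> t y[OF i] s y_s[OF i]])
    finally show ?thesis .
  qed
  then have "\<exists>m>M. arcs_reach (shrink_arc j t \<epsilon>) m"
    using y_s by (intro ex_arcs_reach_greater)
      (meson greaterThanLessThan_iff atLeastAtMost_iff less_imp_le)
  with s show ?thesis by blast
qed

lemma maximin_nodes_interior_point: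
  assumes "maximin_nodes w M" "M > 0" "j \<in> {1..N}"
  shows "\<exists>y\<in>{w j<..<w (Suc j)}. M \<le> sin_prod N q w y"
proof -
  obtain y where y: "y \<in> {w j..w (Suc j)}" "M \<le> sin_prod N q w y"
    using assms unfolding maximin_nodes_def arcs_reach_def by blast
  moreover from this have "y \<noteq> w j" "y \<noteq> w (Suc j)"
    using sin_prod_arc_endpoints[of N w j q] assms by (auto simp: maximin_nodes_def)
  ultimately show ?thesis by (intro bexI[of _ y]) auto
qed

lemma sin_prod_le_maximin:
  assumes N: "N \<ge> 2" and w: "maximin_nodes w M" and "M > 0"
  shows "sin_prod N q w x \<le> M"
proof (rule ccontr)
  assume "\<not> ?thesis"
  then have "sin_prod N q w x > M" by simp
  have cyclic_w: "cyclic_nodes N w" using w by (simp add: maximin_nodes_def)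
  then obtain j z where j: "j \<in> {1..N}" and "z \<in> {w j..<w (Suc j)}"
    and greater: "sin_prod N q w z > M"
    using ex_arc_sin_prod_eq[OF cyclic_w, of q x] N \<open>sin_prod N q w x > M\<close>
    by (metis one_le_numeral order_trans)
  then have z: "z \<in> {w j<..<w (Suc j)}"
    using sin_prod_arc_endpoints(1)[OF cyclic_w j, of q] \<open>M > 0\<close> by (cases "z = w j") auto
  have "\<exists>y. \<forall>i\<in>{1..N}. y i \<in> {w i<..<w (Suc i)} \<and> M \<le> sin_prod N q w (y i)"
    using maximin_nodes_interior_point[OF w \<open>M > 0\<close>] by (intro bchoice) blast
  then obtain y where y: "\<And>i. i \<in> {1..N} \<Longrightarrow> y i \<in> {w i<..<w (Suc i)} \<and> M \<le> sin_prod N q w (y i)"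
    by blast
  have "\<exists>s m. cyclic_nodes N s \<and> arcs_reach s m \<and> m > M"
  proof (rule ex_cyclic_nodes_arcs_reach_greater[OF N cyclic_w _ _ j])
    show "(y(j := z)) i \<in> {w i<..<w (Suc i)}" "M \<le> sin_prod N q w ((y(j := z)) i)"
      if "i \<in> {1..N}" for i
      using y[OF that] z greater by auto
    show "M < sin_prod N q w ((y(j := z)) j)" using greater by simp
  qed
  then show False using w unfolding maximin_nodes_def by (meson not_le)
qed

lemma ex_equioscillating_nodes:
  assumes "N \<ge> 2"
  obtains w M where "equioscillating w M" "w 1 + w N = c"
proof -
  have "N \<ge> 1" using assms by simp
  then obtain v M where v: "maximin_nodes v M" "M > 0"
    by (rule ex_maximin_nodes)
  note le_M = sin_prod_le_maximin[OF assms v]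
  define d where "d = (c - v 1 - v N) / 2"
  define w where "w k = v k + d" for k
  have shift: "sin_prod N q w (x + d) = sin_prod N q v x" for x
    unfolding w_def by (rule sin_prod_shift)
  have "cyclic_nodes N w"
    using v(1) unfolding w_def maximin_nodes_def by (intro cyclic_nodes_shift) blast
  moreover have "sin_prod N q w x \<le> M" for x
    using shift[of "x - d"] le_M[of "x - d"] by simp
  moreover have "\<exists>y\<in>{w j<..<w (Suc j)}. sin_prod N q w y = M" if j: "j \<in> {1..N}" for j
  proof -
    obtain y where "y \<in> {v j<..<v (Suc j)}" "M \<le> sin_prod N q v y"
      using maximin_nodes_interior_point[OF v j] by blast
    then show ?thesis
      using le_M[of y] by (intro bexI[of _ "y + d"]) (auto simp: shift w_def)
  qed
  ultimately have "equioscillating w M" by (simp add: equioscillating_def)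
  moreover have "w 1 + w N = c" by (simp add: w_def d_def)
  ultimately show thesis by (rule that)
qed

end

section \<open>The symmetric minimax problem\<close>

lemma Tfun_eq_sin_prod: "Tfun n r = sin_prod (2 * n) (node_exp n r)"
  by (simp add: Tfun_def sin_prod_def fun_eq_iff)

lemma positive_weights_node_exp:
  assumes "\<forall>k\<in>{1..n}. r k > 0"
  shows "positive_weights (2 * n) (node_exp n r)"
proof
  fix k assume "k \<in> {1..2 * n}"
  then have "(if k \<le> n then n + 1 - k else k - n) \<in> {1..n}" by auto
  moreover have "node_exp n r k = r (if k \<le> n then n + 1 - k else k - n)" by (simp add: node_exp_def)
  ultimately show "node_exp n r k > 0" using assms by simp
qed

lemma Tfun_le_supT:
  assumes "positive_weights (2 * n) (node_exp n r)"
  shows "Tfun n r t x \<le> supT n r t"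
proof -
  interpret positive_weights "2 * n" "node_exp n r" by (rule assms)
  obtain y where y: "y \<in> {0..<0 + 2 * pi}" "[y = x] (rmod (2 * pi))"
    by (rule ex_rcong_ivl)
  have "Tfun n r t x = Tfun n r t y"
    unfolding Tfun_eq_sin_prod using sin_prod_rcong[OF y(2)] by simp
  also have "\<dots> \<le> supT n r t"
    unfolding supT_def using y(1) sin_prod_le_1
    by (intro cSUP_upper bdd_aboveI[of _ 1]) (auto simp: Tfun_eq_sin_prod)
  finally show ?thesis .
qed

lemma supT_le: "(\<And>x. Tfun n r t x \<le> M) \<Longrightarrow> supT n r t \<le> M"
  unfolding supT_def by (intro cSUP_least) auto

lemma supT_cong:
  assumes "\<And>k. k \<in> {1..2 * n} \<Longrightarrow> s k = t k"
  shows "supT n r s = supT n r t"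
  using sin_prod_cong[of "2 * n" s t] assms by (simp add: supT_def Tfun_eq_sin_prod)

definition reflect_nodes :: "nat \<Rightarrow> (nat \<Rightarrow> real) \<Rightarrow> nat \<Rightarrow> real" where
  "reflect_nodes n t k = 2 * pi - t (2 * n + 1 - k)"

lemma node_exp_reflect:
  assumes "k \<in> {1..2 * n}"
  shows "node_exp n r (2 * n + 1 - k) = node_exp n r k"
proof -
  have "k \<le> n \<Longrightarrow> 2 * n + 1 - k - n = n + 1 - k" "\<not> k \<le> n \<Longrightarrow> n + 1 - (2 * n + 1 - k) = k - n"
    using assms by auto
  then show ?thesis using assms by (auto simp: node_exp_def)
qed

lemma Tfun_reflect_nodes: "Tfun n r (reflect_nodes n t) x = Tfun n r t (2 * pi - x)"
proof -
  have factor: "\<bar>sin ((x - (2 * pi - t k)) / 2)\<bar> = \<bar>sin ((2 * pi - x - t k) / 2)\<bar>" for k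
    using sin_minus[of "(2 * pi - x - t k) / 2"] by (simp add: minus_divide_left algebra_simps)
  have "Tfun n r (reflect_nodes n t) x = (\<Prod>k = 1..2*n.
      \<bar>sin ((x - (2 * pi - t (2 * n + 1 - k))) / 2)\<bar> powr node_exp n r (2 * n + 1 - k))"
    unfolding Tfun_def reflect_nodes_def by (intro prod.cong refl) (simp only: node_exp_reflect)
  also have "\<dots> = (\<Prod>k = 1..2*n. \<bar>sin ((x - (2 * pi - t k)) / 2)\<bar> powr node_exp n r k)"
    by (subst (2) prod.atLeastAtMost_rev) simp
  also have "\<dots> = Tfun n r t (2 * pi - x)"
    by (simp add: Tfun_def factor)
  finally show ?thesis .
qed

lemma supT_reflect_nodes: "supT n r (reflect_nodes n t) = supT n r t"
proof -
  have "supT n r t = (SUP x\<in>(\<lambda>x. 2 * pi - x) ` {0..2*pi}. Tfun n r t x)"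
    by (simp add: supT_def)
  then show ?thesis by (simp only: supT_def Tfun_reflect_nodes image_image)
qed

lemma admissible_reflect_nodes:
  assumes "n \<ge> 1" "admissible n t"
  shows "admissible n (reflect_nodes n t)"
  unfolding admissible_def reflect_nodes_def
proof (intro conjI ballI)
  fix k assume k: "k \<in> {1..<2*n}"
  have "t (2 * n - k) \<le> t (Suc (2 * n - k))"
    using assms k unfolding admissible_def by fastforce
  then show "2 * pi - t (2 * n + 1 - k) \<le> 2 * pi - t (2 * n + 1 - Suc k)"
    using k by (simp add: Suc_diff_le)
qed (use assms in \<open>auto simp: admissible_def\<close>)

lemma cyclic_nodes_admissible:
  assumes "n \<ge> 1" "admissible n t"
  shows "cyclic_nodes (2 * n) (t(Suc (2 * n) := t 1 + 2 * pi))"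
  using assms by (auto simp: cyclic_nodes_def admissible_def)

definition strict_minimizer :: "nat \<Rightarrow> (nat \<Rightarrow> real) \<Rightarrow> (nat \<Rightarrow> real) \<Rightarrow> bool" where
  "strict_minimizer n r w \<longleftrightarrow> admissible n w \<and>
     (\<forall>v. admissible n v \<and> (\<exists>k\<in>{1..2*n}. v k \<noteq> w k) \<longrightarrow> supT n r w < supT n r v)"

lemma strict_minimizer_INF:
  assumes "strict_minimizer n r w"
  shows "(INF t\<in>{t. admissible n t}. supT n r t) = supT n r w"
proof -
  have "supT n r w \<le> supT n r v" if "admissible n v" for v
  proof (cases "\<exists>k\<in>{1..2*n}. v k \<noteq> w k")
    case True
    then show ?thesis using assms that by (auto simp: strict_minimizer_def intro: less_imp_le)
  next
    case False
    then show ?thesis using supT_cong[of n v w r] by simp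
  qed
  then show ?thesis
    using assms by (intro cInf_eq_minimum) (auto simp: strict_minimizer_def)
qed

lemma strict_minimizer_unique:
  assumes "strict_minimizer n r w" "admissible n v" "supT n r v = supT n r w" "k \<in> {1..2*n}"
  shows "v k = w k"
  using assms unfolding strict_minimizer_def by (metis less_irrefl)

lemma strict_minimizer_symmetric:
  assumes w: "strict_minimizer n r w" and "n \<ge> 1" and k: "k \<in> {1..2*n}"
  shows "w k = 2 * pi - w (2 * n + 1 - k)"
proof -
  have "admissible n (reflect_nodes n w)"
    using w \<open>n \<ge> 1\<close> by (intro admissible_reflect_nodes) (auto simp: strict_minimizer_def)
  from strict_minimizer_unique[OF w this supT_reflect_nodes k] show ?thesis
    by (simp add: reflect_nodes_def)
qed

lemma ex_strict_minimizer:
  assumes "n \<ge> 1" and weights: "positive_weights (2 * n) (node_exp n r)"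
  obtains w where "strict_minimizer n r w"
    "0 < w 1" "\<And>k. k \<in> {1..<2*n} \<Longrightarrow> w k < w (Suc k)" "w (2 * n) < 2 * pi"
proof -
  interpret positive_weights "2 * n" "node_exp n r" by (rule weights)
  obtain w M where w: "equioscillating w M" and centred: "w 1 + w (2 * n) = 2 * pi"
    using ex_equioscillating_nodes[of "2 * pi"] assms(1) by auto
  have strict: "w k < w (Suc k)" if "k \<in> {1..2*n}" for k
    using w that unfolding equioscillating_def by fastforce
  have "w (Suc (2 * n)) = w 1 + 2 * pi"
    using w by (simp add: equioscillating_def cyclic_nodes_def)
  then have in_range: "0 < w 1" "w (2 * n) < 2 * pi"
    using strict[of "2 * n"] assms(1) centred by auto
  then have "admissible n w"
    using strict centred by (auto simp: admissible_def less_imp_le)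
  moreover have "supT n r w < supT n r v" if v: "admissible n v" "k \<in> {1..2*n}" "v k \<noteq> w k" for v k
  proof -
    define u where "u = v(Suc (2 * n) := v 1 + 2 * pi)"
    have u_eq: "u k = v k" if "k \<in> {1..2*n}" for k using that by (auto simp: u_def)
    have "u 1 + u (2 * n) = w 1 + w (2 * n)"
      using v(1) u_eq[of 1] u_eq[of "2 * n"] assms(1) centred by (simp add: admissible_def)
    moreover have "cyclic_nodes (2 * n) u"
      unfolding u_def using assms(1) v(1) by (rule cyclic_nodes_admissible)
    moreover have "u k \<noteq> w k" using u_eq[OF v(2)] v(3) by simp
    ultimately obtain x where "M < sin_prod (2 * n) (node_exp n r) u x"
      using sin_prod_above_equioscillation[OF w _ _ v(2)] by blast
    moreover have "supT n r w \<le> M"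
      using w by (intro supT_le) (simp add: Tfun_eq_sin_prod equioscillating_def)
    ultimately have "supT n r w < Tfun n r u x" by (simp add: Tfun_eq_sin_prod)
    also have "\<dots> \<le> supT n r u" by (rule Tfun_le_supT[OF weights])
    also have "\<dots> = supT n r v" using u_eq by (rule supT_cong)
    finally show ?thesis .
  qed
  ultimately have "strict_minimizer n r w" unfolding strict_minimizer_def by blast
  then show thesis using in_range strict by (intro that) auto
qed

theorem theorem13p4:
  fixes n :: nat and r :: "nat \<Rightarrow> real"
  assumes "n \<ge> 1" and "\<forall>k\<in>{1..n}. r k > 0"
  shows "\<exists>w. admissible n w
           \<and> supT n r w = (INF tt\<in>{tt. admissible n tt}. supT n r tt)
           \<and> (\<forall>v. admissible n v \<and> supT n r v = (INF tt\<in>{tt. admissible n tt}. supT n r tt)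
                  \<longrightarrow> (\<forall>k\<in>{1..2*n}. v k = w k))
           \<and> w 1 + (w (2*n) - 2*pi) = 0
           \<and> 0 < w 1 \<and> (\<forall>k\<in>{1..<2*n}. w k < w (Suc k)) \<and> w (2*n) < 2*pi
           \<and> (\<forall>k\<in>{1..n}. w k = 2*pi - w (2*n + 1 - k))"
proof -
  obtain w where w: "strict_minimizer n r w"
    and ordered: "0 < w 1" "\<And>k. k \<in> {1..<2*n} \<Longrightarrow> w k < w (Suc k)" "w (2*n) < 2*pi"
    using ex_strict_minimizer[OF assms(1) positive_weights_node_exp[OF assms(2)]] by blast
  show ?thesis
    unfolding strict_minimizer_INF[OF w]
  proof (intro exI[of _ w] conjI allI impI ballI)
    show "admissible n w" and "w 1 + (w (2*n) - 2*pi) = 0"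
      using w by (auto simp: strict_minimizer_def admissible_def)
    show "v k = w k" if "admissible n v \<and> supT n r v = supT n r w" "k \<in> {1..2*n}" for v k
      using strict_minimizer_unique[OF w] that by blast
    show "w k = 2*pi - w (2*n + 1 - k)" if "k \<in> {1..n}" for k
      using that by (intro strict_minimizer_symmetric[OF w assms(1)]) auto
  qed (use ordered in auto)
qed

end
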